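(* Let $(X,\preceq)$ be a locally compact and order-connected topological poset that satisfies the countable-chain condition, and let $f:X\to X$ be an order-preserving and continuous map. If $f(x)\preceq x$ for some $x\in X$, then $f$ has a fixed point.
   Context: A topological poset is a poset $(X,\preceq)$ with $X$ a nonempty topological space such that $\preceq$ is a closed subset of $X\times X$ (product topology). Writing $x^{\downarrow}:=\{z\in X:z\preceq x\}$ and $x^{\uparrow}:=\{z\in X:x\preceq z\}$, it is order-connected if $x^{\uparrow}\cap y^{\downarrow}$ is a connected subset of $X$ for all $x,y\in X$ with $x\preceq y$. The countable-chain condition here means: the greatest lower bound $\bigwedge S$ exists for every nonempty countable chain $S$ in $(X,\preceq)$. A map $f$ is order-preserving if $x\preceq y$ implies $f(x)\preceq f(y)$. *)

theory Defs
  imports "HOL-Analysis.Analysis" "HOL-Library.Lub_Glb"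
begin

(* In each definition the itself argument only names the ambient poset. The first is not a
   type class because a class axiom cannot mention the topology of the product 'a \<times> 'a. *)

definition topological_poset :: "'a::{order,topological_space} itself \<Rightarrow> bool" where
  "topological_poset _ \<longleftrightarrow> closed {(x :: 'a, y). x \<le> y}"

definition order_connected :: "'a::{order,topological_space} itself \<Rightarrow> bool" where
  "order_connected _ \<longleftrightarrow> (\<forall>x y :: 'a. x \<le> y \<longrightarrow> connected ({x..} \<inter> {..y}))"

definition countable_chain_condition :: "'a::order itself \<Rightarrow> bool" where
  "countable_chain_condition _ \<longleftrightarrow>
     (\<forall>S :: 'a set. S \<noteq> {} \<and> countable S \<and> Complete_Partial_Order.chain (\<le>) S
        \<longrightarrow> (\<exists>g. isGlb UNIV S g))"

end

theory Submission
  imports Defs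
begin

text \<open>
  The fixed point is the limit of the iterates of \<open>f\<close> at a point \<open>x\<close> with \<open>f x \<le> x\<close>. Since \<open>f\<close> is
  monotone, the iterates decrease, and the chain condition gives them a greatest lower bound \<open>g\<close>.
  As \<open>f g\<close> is again a lower bound of the iterates, \<open>f g \<le> g\<close>. For the converse inequality
  continuity must be brought in, and this requires the order-theoretic infimum \<open>g\<close> to be a
  topological limit. In a general topological poset it need not be one; local compactness and
  order-connectedness together force it to be one (\<open>decseq_tendsto_Glb\<close>), since a sequence that
  stays away from \<open>g\<close> would make every interval from \<open>g\<close> to a term cross a compact frontier around
  \<open>g\<close>, and compactness would leave on that frontier a lower bound strictly above \<open>g\<close>. Once the
  iterates converge to \<open>g\<close>, their images converge to \<open>f g\<close>; these lie above \<open>g\<close>, and the order is closed, so \<open>g \<le> f g\<close>.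
\<close>

text \<open>By antisymmetry, distinct points can be named so that \<open>x \<le> y\<close> fails. A basic open
  box around \<open>(x, y)\<close> that avoids the closed order cannot contain a diagonal point, so its sides
  are disjoint.\<close>

lemma topological_poset_imp_Hausdorff:
  assumes "topological_poset TYPE('a::{order,topological_space})"
  shows "Hausdorff_space (euclidean :: 'a topology)"
proof -
  have sep: "\<exists>A B. open A \<and> open B \<and> x \<in> A \<and> y \<in> B \<and> disjnt A B" if "\<not> x \<le> y" for x y :: 'a
  proof -
    have "open (- {(x :: 'a, y). x \<le> y})"
      using assms by (simp add: topological_poset_def open_Compl)
    moreover have "(x, y) \<in> - {(x :: 'a, y). x \<le> y}"
      using that by simp
    ultimately obtain A B where "open A" "open B" "(x, y) \<in> A \<times> B"
      and AB: "A \<times> B \<subseteq> - {(x :: 'a, y). x \<le> y}"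
      by (rule open_prod_elim)
    moreover from AB have "disjnt A B"
      by (auto simp: disjnt_iff)
    ultimately show ?thesis by blast
  qed
  show ?thesis
    unfolding Hausdorff_space_def
  proof (intro allI impI)
    fix x y :: 'a
    assume "x \<in> topspace euclidean \<and> y \<in> topspace euclidean \<and> x \<noteq> y"
    then consider "\<not> x \<le> y" | "\<not> y \<le> x"
      by (auto dest: antisym)
    then show "\<exists>U V. openin euclidean U \<and> openin euclidean V \<and> x \<in> U \<and> y \<in> V \<and> disjnt U V"
      by cases (use sep disjnt_sym in \<open>metis open_openin\<close>)+
  qed
qed

lemma topological_poset_closed_rays:
  fixes a :: "'a::{order,topological_space}"
  assumes "topological_poset TYPE('a)"
  shows "closed {a..}" and "closed {..a}"
proof -
  have cl: "closed {(x :: 'a, y). x \<le> y}"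
    using assms by (simp add: topological_poset_def)
  have "closed ((\<lambda>x. (a, x)) -` {(x, y). x \<le> y})"
    by (rule closed_vimage[OF cl]) (intro continuous_intros)
  then show "closed {a..}"
    by (simp add: vimage_def atLeast_def)
  have "closed ((\<lambda>x. (x, a)) -` {(x, y). x \<le> y})"
    by (rule closed_vimage[OF cl]) (intro continuous_intros)
  then show "closed {..a}"
    by (simp add: vimage_def atMost_def)
qed

text \<open>Let \<open>W\<close> be a relatively compact open neighbourhood of \<open>g\<close>. If \<open>s n\<close> lies outside \<open>W\<close>, the
  connected interval from \<open>g\<close> to \<open>s n\<close> meets the compact frontier of \<open>W\<close>. These traces on the
  frontier shrink as \<open>n\<close> grows. Were none of them empty, they would have a common point, which is a
  lower bound of the sequence above \<open>g\<close> and hence \<open>g\<close> itself; but \<open>g\<close> is interior to \<open>W\<close>. So the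
  traces are eventually empty, and from then on the sequence stays in \<open>W\<close>.\<close>

lemma decseq_tendsto_Glb:
  fixes s :: "nat \<Rightarrow> 'a::{order,topological_space}"
  assumes poset: "topological_poset TYPE('a)"
    and loc_compact: "locally_compact_space (euclidean :: 'a topology)"
    and conn: "order_connected TYPE('a)"
    and dec: "decseq s"
    and glb: "isGlb UNIV (range s) g"
  shows "s \<longlonglongrightarrow> g"
proof (rule topological_tendstoI)
  fix V assume "open V" "g \<in> V"
  have lower: "g \<le> s n" for n
    using glb by (auto simp: isGlb_def isLb_def greatestP_def setge_def)
  have greatest: "z \<le> g" if "\<And>n. z \<le> s n" for z
    using glb that by (auto simp: isGlb_def isLb_def greatestP_def setge_def setle_def)
  obtain U K where "open U" "compact K" "g \<in> U" "U \<subseteq> K"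
    using loc_compact unfolding locally_compact_space_def by simp metis
  have "closed K"
    using compactin_imp_closedin[OF topological_poset_imp_Hausdorff[OF poset], of K] \<open>compact K\<close>
    by simp
  define W where "W = U \<inter> V"
  have "open W" "g \<in> W" "W \<subseteq> V"
    using \<open>open U\<close> \<open>open V\<close> \<open>g \<in> U\<close> \<open>g \<in> V\<close> by (auto simp: W_def)
  have "closure W \<subseteq> K"
    using \<open>U \<subseteq> K\<close> \<open>closed K\<close> by (intro closure_minimal) (auto simp: W_def)
  define T where "T n = frontier W \<inter> ({g..} \<inter> {..s n})" for n
  have T_closed: "closed (T n)" for n
    unfolding T_def by (intro closed_Int frontier_closed topological_poset_closed_rays poset)
  have T_sub: "T n \<subseteq> K" for n
    using \<open>closure W \<subseteq> K\<close> by (auto simp: T_def frontier_def)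
  have "decseq T"
    unfolding T_def using decseqD[OF dec] by (intro antimonoI Int_mono) auto
  have "\<exists>N. T N = {}"
  proof (rule ccontr)
    assume "\<nexists>N. T N = {}"
    then have "(\<Inter>n. T n) \<noteq> {}"
      using \<open>compact K\<close> T_closed T_sub \<open>decseq T\<close>
      by (intro compact_space_imp_nest[of "top_of_set K"])
        (simp_all add: compact_space_subtopology closed_subset)
    then obtain z where z: "z \<in> T n" for n by blast
    then have "z \<le> g" "g \<le> z"
      using greatest by (auto simp: T_def)
    then have "g \<in> frontier W"
      using z by (auto simp: T_def)
    then show False
      using \<open>open W\<close> \<open>g \<in> W\<close> by (simp add: frontier_def interior_open)
  qed
  then obtain N where "T N = {}" by blast
  have "s n \<in> W" if "N \<le> n" for n
  proof (rule ccontr)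
    assume "s n \<notin> W"
    have "connected ({g..} \<inter> {..s n})"
      using conn lower by (simp add: order_connected_def)
    then have "({g..} \<inter> {..s n}) \<inter> frontier W \<noteq> {}"
      using \<open>s n \<notin> W\<close> \<open>g \<in> W\<close> lower[of n] by (intro connected_Int_frontier) auto
    moreover have "T n = {}"
      using decseqD[OF \<open>decseq T\<close> that] \<open>T N = {}\<close> by simp
    ultimately show False by (auto simp: T_def)
  qed
  then show "\<forall>\<^sub>F n in sequentially. s n \<in> V"
    using \<open>W \<subseteq> V\<close> by (auto simp: eventually_sequentially)
qed

theorem theorem23:
  fixes f :: "'a::{order,topological_space} \<Rightarrow> 'a"
  assumes "topological_poset TYPE('a)"
    and "locally_compact_space (euclidean :: 'a topology)"
    and "order_connected TYPE('a)"
    and "countable_chain_condition TYPE('a)"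
    and "mono f"
    and "continuous_on UNIV f"
    and "\<exists>x. f x \<le> x"
  shows "\<exists>x. f x = x"
proof -
  obtain x where "f x \<le> x"
    using assms(7) by blast
  define s where "s n = (f ^^ n) x" for n
  have f_s: "f (s n) = s (Suc n)" for n
    by (simp add: s_def)
  have "s (Suc n) \<le> s n" for n
    by (induction n) (use \<open>f x \<le> x\<close> monoD[OF \<open>mono f\<close>] in \<open>auto simp: s_def\<close>)
  then have dec: "decseq s"
    by (simp add: decseq_SucI)
  have "Complete_Partial_Order.chain (\<le>) (range s)"
    unfolding chain_def by (metis decseqD[OF dec] nat_le_linear rangeE)
  moreover have "range s \<noteq> {}" "countable (range s)"
    by simp_all
  ultimately obtain g where g: "isGlb UNIV (range s) g"
    using assms(4) unfolding countable_chain_condition_def by metis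
  then have lower: "g \<le> s n" for n
    by (rule isGlbD2) simp
  have "f g \<le> s n" for n
    using monoD[OF \<open>mono f\<close> lower[of n]] decseqD[OF dec, of n "Suc n"] f_s[of n] by simp
  then have "f g \<le> g"
    using g by (auto simp: isGlb_def isLb_def greatestP_def setge_def setle_def)
  moreover have "g \<le> f g"
  proof -
    have "s \<longlonglongrightarrow> g"
      using decseq_tendsto_Glb[OF assms(1-3) dec g] .
    then have "(\<lambda>n. f (s n)) \<longlonglongrightarrow> f g"
      by (rule continuous_on_tendsto_compose[OF \<open>continuous_on UNIV f\<close>]) auto
    then have "f g \<in> {g..}"
      using lower f_s topological_poset_closed_rays(1)[OF assms(1)]
      by (intro Lim_in_closed_set[of _ "\<lambda>n. f (s n)" sequentially]) auto
    then show ?thesis by simp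
  qed
  ultimately show ?thesis
    using antisym by blast
qed

end
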